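(* For every positive integer $k$ and every integer $n$ with $2^{k-1}+1\le n\le 2^{k-1}+2^{\lfloor 3k/4\rfloor-1}$, there exists a planar broadcast graph on $n$ vertices with broadcast time $k$.
   Context: Broadcasting: initially only an originator holds a message; in each discrete time unit, every informed vertex may inform at most one uninformed neighbor. $b(v,G)$ is the minimum number of time units to inform all vertices from originator $v$, $b(G)=\max_v b(v,G)$ is the broadcast time of $G$, and a connected graph $G$ on $n$ vertices is a broadcast graph if $b(G)=\lceil\log_2 n\rceil$. *)

theory Defs
  imports "HOL-Analysis.Analysis" "Graph_Theory.Digraph_Component"
begin

text \<open>
  Finite simple graphs are the symmetric, loop-free finite digraphs of locale
  \<^locale>\<open>pair_graph\<close>; the two arcs \<open>(u, v)\<close> and \<open>(v, u)\<close> together are one undirected edge.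
\<close>

definition undirected_edges :: "'a pair_pre_digraph \<Rightarrow> 'a set set" where
  "undirected_edges G = (\<lambda>(u, v). {u, v}) ` parcs G"

text \<open>
  One time unit turns the set \<open>I\<close> of informed vertices into \<open>I'\<close>. A call \<open>(u, w) \<in> C\<close> goes from an
  informed vertex to an uninformed neighbour, and injectivity of \<^const>\<open>fst\<close> on \<open>C\<close> allows each
  informed vertex at most one call. Several calls to the same vertex are harmless: they inform
  no more vertices than one of them does.
\<close>

definition broadcast_step :: "'a pair_pre_digraph \<Rightarrow> 'a set \<Rightarrow> 'a set \<Rightarrow> bool" where
  "broadcast_step G I I' \<longleftrightarrow>
     (\<exists>C \<subseteq> parcs G. inj_on fst C \<and> fst ` C \<subseteq> I \<and> snd ` C \<inter> I = {} \<and> I' = I \<union> snd ` C)"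

text \<open>
  The minimum exists whenever \<open>G\<close> is a finite connected graph and \<open>v\<close> one of its vertices;
  otherwise the value of the \<open>LEAST\<close> may be unspecified.
\<close>

definition broadcast_time_from :: "'a pair_pre_digraph \<Rightarrow> 'a \<Rightarrow> nat" where
  "broadcast_time_from G v = (LEAST t. (broadcast_step G ^^ t) {v} (pverts G))"

definition broadcast_time :: "'a pair_pre_digraph \<Rightarrow> nat" where
  "broadcast_time G = Max (broadcast_time_from G ` pverts G)"

definition broadcast_graph :: "'a pair_pre_digraph \<Rightarrow> bool" where
  "broadcast_graph G \<longleftrightarrow>
     pair_graph G \<and> Digraph_Component.connected (with_proj G) \<and>
     int (broadcast_time G) = \<lceil>log 2 (real (card (pverts G)))\<rceil>"

text \<open>
  A drawing in the plane \<^typ>\<open>complex\<close> places the vertices at distinct points and draws every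
  edge as a simple arc joining its two ends. An arc meets no other vertex, and two arcs meet only
  in common ends.
\<close>

definition plane_drawing ::
  "'a pair_pre_digraph \<Rightarrow> ('a \<Rightarrow> complex) \<Rightarrow> ('a set \<Rightarrow> real \<Rightarrow> complex) \<Rightarrow> bool" where
  "plane_drawing G p \<gamma> \<longleftrightarrow>
     inj_on p (pverts G) \<and>
     (\<forall>e \<in> undirected_edges G.
        Path_Connected.arc (\<gamma> e) \<and>
        {pathstart (\<gamma> e), pathfinish (\<gamma> e)} = p ` e \<and>
        path_image (\<gamma> e) \<inter> p ` pverts G = p ` e) \<and>
     (\<forall>e \<in> undirected_edges G. \<forall>f \<in> undirected_edges G. e \<noteq> f \<longrightarrow>
        path_image (\<gamma> e) \<inter> path_image (\<gamma> f) = p ` (e \<inter> f))"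

definition planar :: "'a pair_pre_digraph \<Rightarrow> bool" where
  "planar G \<longleftrightarrow> (\<exists>p \<gamma>. plane_drawing G p \<gamma>)"

end

(*
  Proof idea. Join an apex r to all vertices of an outerplanar graph H made from the binomial tree
  of dimension k - 1. An originator v first calls r. With its other k - 1 rounds, v informs only
  the subtree K of dimension a = floor(3k/4) - 1 containing v. Deleting the root of a subtree of
  size 2^a from the tree of such roots leaves what r can reach in k - 1 - a calls, so r saves a
  rounds and can inform about 2^a further vertices. Within K, shortcut edges that respect
  outerplanarity bring every vertex within about a/3 of the root of K; a message from v reaches
  that root in time because a + a/3 is about k.
*)

theory Submission
  imports Defs
begin

section \<open>Composing broadcast schemes\<close>

text \<open>The factor 3 comes from the sibling edges. Apart from the apex, its parent and its
  children, a vertex of H is adjacent only to the siblings just before and just after it. When a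
  parent spends \<open>j\<close> rounds on a cluster, the vertex that it calls first has
  \<open>j - 1\<close> rounds left. It gives one call to each side of the row of siblings and keeps
  \<open>j - 3\<close> rounds for its own children. So each level of depth uses up three dimensions,
  while sibling edges still nest when the vertices are listed in preorder. The additional vertices
  hang below the same vertex of H as the rest, and the roots among them are adjacent to it and to
  the apex. Hence either of the two can inform them. This matters because an originator may itself
  be an additional vertex or the apex, and then the two exchange tasks.\<close>

abbreviation informs :: "'a pair_pre_digraph \<Rightarrow> nat \<Rightarrow> 'a set \<Rightarrow> 'a set \<Rightarrow> bool" where
  "informs G t \<equiv> broadcast_step G ^^ t"

lemma broadcast_stepI:
  "\<lbrakk>C \<subseteq> parcs G; inj_on fst C; fst ` C \<subseteq> I; snd ` C \<inter> I = {}; I' = I \<union> snd ` C\<rbrakk>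
    \<Longrightarrow> broadcast_step G I I'"
  unfolding broadcast_step_def by blast

lemma broadcast_step_refl: "broadcast_step G I I"
  by (rule broadcast_stepI[of "{}"]) auto

lemma broadcast_step_subset: "broadcast_step G I I' \<Longrightarrow> I \<subseteq> I'"
  unfolding broadcast_step_def by auto

lemma broadcast_step_call:
  assumes "(u, w) \<in> parcs G" "u \<in> I"
  shows "broadcast_step G I (insert w I)"
proof (cases "w \<in> I")
  case True
  then show ?thesis by (simp add: insert_absorb broadcast_step_refl)
next
  case False
  then show ?thesis using assms by (intro broadcast_stepI[of "{(u, w)}"]) auto
qed

text \<open>Calls to vertices that \<open>L\<close> has already informed are dropped, since a call
  must reach an uninformed vertex.\<close>

lemma broadcast_step_mono:
  assumes "broadcast_step G I J"
  shows "broadcast_step G (I \<union> L) (J \<union> L)"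
proof -
  obtain C where C: "C \<subseteq> parcs G" "inj_on fst C" "fst ` C \<subseteq> I" "J = I \<union> snd ` C"
    using assms unfolding broadcast_step_def by blast
  show ?thesis
    by (rule broadcast_stepI[of "{c \<in> C. snd c \<notin> I \<union> L}"])
      (use C in \<open>auto intro: inj_on_subset\<close>)
qed

text \<open>Disjoint final sets keep the callers apart, and neither scheme calls a vertex that the
  other has informed. For this reason schemes record their exact final sets and not just lower
  bounds for them.\<close>

lemma broadcast_step_parallel:
  assumes "broadcast_step G I I'" "broadcast_step G J J'" "I' \<inter> J' = {}"
  shows "broadcast_step G (I \<union> J) (I' \<union> J')"
proof -
  obtain C where C: "C \<subseteq> parcs G" "inj_on fst C" "fst ` C \<subseteq> I" "snd ` C \<inter> I = {}" "I' = I \<union> snd ` C"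
    using assms(1) unfolding broadcast_step_def by blast
  obtain D where D: "D \<subseteq> parcs G" "inj_on fst D" "fst ` D \<subseteq> J" "snd ` D \<inter> J = {}" "J' = J \<union> snd ` D"
    using assms(2) unfolding broadcast_step_def by blast
  have "inj_on fst (C \<union> D)"
    using C D assms(3) unfolding inj_on_Un by blast
  moreover have "snd ` (C \<union> D) \<inter> (I \<union> J) = {}"
    using C(4,5) D(4,5) assms(3) by (simp add: image_Un) blast
  ultimately show ?thesis
    using C D by (intro broadcast_stepI[of "C \<union> D"]) (simp_all add: image_Un Un_ac le_supI1 le_supI2)
qed

text \<open>Idle rounds are allowed, so a scheme may always be padded to a larger number of
  rounds.\<close>

lemma informs_refl: "informs G t I I"
  by (induction t) (auto intro: broadcast_step_refl)

lemma informs_trans: "informs G s I J \<Longrightarrow> informs G t J V \<Longrightarrow> informs G (s + t) I V"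
  by (auto simp: relpowp_add)

lemma informs_le: "informs G s I V \<Longrightarrow> s \<le> t \<Longrightarrow> informs G t I V"
  using informs_trans[OF _ informs_refl, of s G I V "t - s"] by simp

lemma informs_mono: "informs G t I V \<Longrightarrow> informs G t (I \<union> L) (V \<union> L)"
  by (induction t arbitrary: V) (auto intro: broadcast_step_mono)

lemma informs_from_superset: "informs G t I V \<Longrightarrow> I \<subseteq> J \<Longrightarrow> J \<subseteq> V \<Longrightarrow> informs G t J V"
  using informs_mono[of t G I V J] by (simp add: Un_absorb1 Un_absorb2)

lemma informs_parallel:
  "informs G t I V \<Longrightarrow> informs G t J W \<Longrightarrow> V \<inter> W = {} \<Longrightarrow> informs G t (I \<union> J) (V \<union> W)"
proof (induction t arbitrary: V W)
  case (Suc t)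
  then obtain V' W' where step: "informs G t I V'" "broadcast_step G V' V"
      "informs G t J W'" "broadcast_step G W' W"
    by auto
  then have "V' \<inter> W' = {}"
    using broadcast_step_subset Suc.prems(3) by blast
  with step Suc show ?case
    by (meson broadcast_step_parallel relpowp_Suc_I)
qed simp

text \<open>The doubling step of binomial broadcasting: after one call the two ends work
  independently on disjoint sets.\<close>

lemma informs_call:
  assumes "informs G t {x} S" "informs G t {y} T" "S \<inter> T = {}" "(x, y) \<in> parcs G"
  shows "informs G (Suc t) {x} (S \<union> T)"
proof -
  have "broadcast_step G {x} ({x} \<union> {y})"
    using broadcast_step_call[of x y G "{x}"] assms(4) by (simp add: insert_commute)
  then show ?thesis
    using informs_parallel[OF assms(1-3)] by (rule relpowp_Suc_I2)
qed

section \<open>Doubling bound on the number of informed vertices\<close>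

lemma card_broadcast_step_le:
  assumes "broadcast_step G I I'" "finite I"
  shows "finite I' \<and> card I' \<le> 2 * card I"
proof -
  obtain C where C: "inj_on fst C" "fst ` C \<subseteq> I" "I' = I \<union> snd ` C"
    using assms(1) unfolding broadcast_step_def by auto
  have fin: "finite C" and "card C \<le> card I"
    using C(1,2) assms(2) by (auto intro: inj_on_finite card_inj_on_le)
  then have "card (snd ` C) \<le> card I"
    using card_image_le[OF fin, of snd] by simp
  then show ?thesis
    using C(3) fin assms(2) card_Un_le[of I "snd ` C"] by simp
qed

lemma card_informs_le:
  "informs G t I V \<Longrightarrow> finite I \<Longrightarrow> finite V \<and> card V \<le> 2 ^ t * card I"
proof (induction t arbitrary: V)
  case (Suc t)
  then obtain V' where V': "informs G t I V'" "broadcast_step G V' V"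
    by auto
  then show ?case
    using Suc.IH[OF V'(1) Suc.prems(2)] card_broadcast_step_le[OF V'(2)] by fastforce
qed simp

text \<open>Counting alone gives the lower bound, so only schemes with \<open>k\<close> rounds
  remain to be constructed.\<close>

lemma broadcast_time_eqI:
  assumes "finite (pverts G)" "2 ^ (k - 1) < card (pverts G)"
    and "\<And>v. v \<in> pverts G \<Longrightarrow> informs G k {v} (pverts G)"
  shows "broadcast_time G = k"
proof -
  have "broadcast_time_from G v = k" if "v \<in> pverts G" for v
    unfolding broadcast_time_from_def
  proof (rule Least_equality)
    fix t assume "informs G t {v} (pverts G)"
    then have "card (pverts G) \<le> 2 ^ t"
      using card_informs_le[of t G "{v}" "pverts G"] by simp
    with assms(2) have "(2::nat) ^ (k - 1) < 2 ^ t"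
      by (rule less_le_trans)
    then have "k - 1 < t"
      by (rule power_less_imp_less_exp[rotated]) simp
    then show "k \<le> t"
      by simp
  qed (use assms(3) that in blast)
  then have "broadcast_time_from G ` pverts G = {k}"
    using assms(2) by (cases "pverts G = {}") auto
  then show ?thesis
    by (simp add: broadcast_time_def)
qed

section \<open>Fan graphs of ordered forests\<close>

text \<open>
  \<open>Plant f g\<close> is the ordered forest whose first tree has the children \<open>f\<close>, followed by the trees
  of \<open>g\<close>. The nodes are numbered in preorder from \<open>s\<close>, and \<open>p\<close> is a common parent of the roots;
  in addition to the tree edges, consecutive siblings are adjacent.
\<close>

datatype oforest = Empty | Plant oforest oforest

primrec nodes :: "oforest \<Rightarrow> nat" where
  "nodes Empty = 0"
| "nodes (Plant f g) = Suc (nodes f + nodes g)"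

primrec depth :: "oforest \<Rightarrow> nat" where
  "depth Empty = 0"
| "depth (Plant f g) = max (Suc (depth f)) (depth g)"

primrec fappend :: "oforest \<Rightarrow> oforest \<Rightarrow> oforest" (infixr "\<frown>" 65) where
  "Empty \<frown> h = h"
| "Plant f g \<frown> h = Plant f (g \<frown> h)"

primrec roots :: "nat \<Rightarrow> oforest \<Rightarrow> nat set" where
  "roots s Empty = {}"
| "roots s (Plant f g) = insert s (roots (Suc (s + nodes f)) g)"

text \<open>Left end of the sibling edge that arises when a further forest is appended. The value at
  \<open>Empty\<close> is a default.\<close>

primrec last_root :: "nat \<Rightarrow> oforest \<Rightarrow> nat" where
  "last_root s Empty = s"
| "last_root s (Plant f g) = (if g = Empty then s else last_root (Suc (s + nodes f)) g)"

primrec fan_edges :: "nat \<Rightarrow> nat \<Rightarrow> oforest \<Rightarrow> (nat \<times> nat) set" where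
  "fan_edges p s Empty = {}"
| "fan_edges p s (Plant f g) =
     {(p, s)} \<union> fan_edges s (Suc s) f \<union> fan_edges p (Suc (s + nodes f)) g \<union>
     (if g = Empty then {} else {(s, Suc (s + nodes f))})"

lemma nodes_append [simp]: "nodes (f \<frown> g) = nodes f + nodes g"
  by (induction f) auto

lemma depth_append [simp]: "depth (f \<frown> g) = max (depth f) (depth g)"
  by (induction f) auto

lemma append_eq_Empty_iff [simp]: "f \<frown> g = Empty \<longleftrightarrow> f = Empty \<and> g = Empty"
  by (cases f) auto

lemma roots_append: "roots s (f \<frown> g) = roots s f \<union> roots (s + nodes f) g"
  by (induction f arbitrary: s) (auto simp: add.assoc)

lemma roots_bounds: "roots s f \<subseteq> {s..<s + nodes f}"
  by (induction f arbitrary: s) fastforce+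

lemma last_root_append:
  "last_root s (f \<frown> g) = (if g = Empty then last_root s f else last_root (s + nodes f) g)"
  by (induction f arbitrary: s) (auto simp: add.assoc)

lemma fan_edges_append:
  "fan_edges p s (f \<frown> g) = fan_edges p s f \<union> fan_edges p (s + nodes f) g \<union>
     (if f = Empty \<or> g = Empty then {} else {(last_root s f, s + nodes f)})"
  by (induction f arbitrary: s) (auto simp: add.assoc)

lemma fan_edges_roots: "x \<in> roots s f \<Longrightarrow> (p, x) \<in> fan_edges p s f"
  by (induction f arbitrary: s) auto

lemma fan_edges_bounds:
  "(x, y) \<in> fan_edges p s f \<Longrightarrow> p < s \<Longrightarrow> x < y \<and> s \<le> y \<and> y < s + nodes f \<and> (x = p \<or> s \<le> x)"
proof (induction f arbitrary: p s)
  case (Plant f g)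
  have 1: "x < y \<and> Suc s \<le> y \<and> y < Suc s + nodes f \<and> (x = s \<or> Suc s \<le> x)"
    if "(x, y) \<in> fan_edges s (Suc s) f"
    using Plant.IH(1)[OF that] by simp
  have 2: "x < y \<and> Suc (s + nodes f) \<le> y \<and> y < Suc (s + nodes f) + nodes g \<and> (x = p \<or> Suc (s + nodes f) \<le> x)"
    if "(x, y) \<in> fan_edges p (Suc (s + nodes f)) g"
    using Plant.IH(2)[OF that] Plant.prems by simp
  have 3: "nodes g > 0" if "g \<noteq> Empty"
    using that by (cases g) auto
  show ?case
    using Plant.prems 1 2 3 by (auto split: if_splits)
qed simp

text \<open>Preorder keeps the first tree in an interval of its own. Edges of the later trees start
  at \<open>p\<close> or lie beyond this interval, and the sibling edge from \<open>s\<close> ends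
  just behind it, so edges of different parts nest or lie side by side.\<close>

lemma fan_edges_noncrossing:
  assumes "(x, y) \<in> fan_edges p s f" "(x', y') \<in> fan_edges p s f" "p < s"
  shows "\<not> (x < x' \<and> x' < y \<and> y < y')"
  using assms
proof (induction f arbitrary: p s)
  case (Plant f g)
  let ?q = "Suc (s + nodes f)"
  have inner: "u < w \<and> Suc s \<le> w \<and> w < ?q \<and> s \<le> u"
    if "(u, w) \<in> fan_edges s (Suc s) f" for u w
    using fan_edges_bounds[OF that] by auto
  have right: "u < w \<and> ?q \<le> w \<and> (u = p \<or> ?q \<le> u)"
    if "(u, w) \<in> fan_edges p ?q g" for u w
    using fan_edges_bounds[OF that] Plant.prems(3) by auto
  let ?split = "\<lambda>u w. u = p \<and> w = s \<or> u = s \<and> w = ?q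
    \<or> (u, w) \<in> fan_edges s (Suc s) f \<and> s \<le> u \<and> u < w \<and> Suc s \<le> w \<and> w < ?q
    \<or> (u, w) \<in> fan_edges p ?q g \<and> u = p \<and> ?q \<le> w
    \<or> (u, w) \<in> fan_edges p ?q g \<and> ?q \<le> u \<and> u < w"
  have split: "?split u w" if "(u, w) \<in> fan_edges p s (Plant f g)" for u w
    using that inner[of u w] right[of u w] by (auto split: if_splits)
  note cases = split[OF Plant.prems(1)] split[OF Plant.prems(2)]
  \<comment> \<open>Only two edges of the same recursive part need an induction hypothesis; the
    inequalities in \<open>?split\<close> settle every other pair.\<close>
  consider "(x, y) \<in> fan_edges s (Suc s) f" "(x', y') \<in> fan_edges s (Suc s) f"
    | "(x, y) \<in> fan_edges p ?q g" "(x', y') \<in> fan_edges p ?q g"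
    | "\<not> ((x, y) \<in> fan_edges s (Suc s) f \<and> (x', y') \<in> fan_edges s (Suc s) f)"
      "\<not> ((x, y) \<in> fan_edges p ?q g \<and> (x', y') \<in> fan_edges p ?q g)"
    by blast
  then show ?case
  proof cases
    case 1
    then show ?thesis by (rule Plant.IH(1)) simp
  next
    case 2
    then show ?thesis by (rule Plant.IH(2)) (use Plant.prems(3) in simp)
  next
    case 3
    then show ?thesis
      using cases Plant.prems(3) by (elim disjE conjE) (linarith | blast)+
  qed
qed simp


section \<open>Planarity\<close>

text \<open>The graph of \<open>(x - a) * (b - x)\<close> over the interval from \<open>a\<close> to
  \<open>b\<close>. Because all these parabolas share the leading coefficient -1, nested intervals
  give nested curves.\<close>

definition parabola :: "real \<Rightarrow> real \<Rightarrow> real \<Rightarrow> complex" where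
  "parabola a b t = Complex (a + t * (b - a)) (t * (1 - t) * (b - a)\<^sup>2)"

lemma arc_parabola:
  assumes "a < b"
  shows "Path_Connected.arc (parabola a b)"
  unfolding Path_Connected.arc_def Path_Connected.path_def
proof
  show "continuous_on {0..1} (parabola a b)"
    unfolding parabola_def Complex_eq by (intro continuous_intros)
  show "inj_on (parabola a b) {0..1}"
    using assms by (auto simp: inj_on_def parabola_def)
qed

lemma path_image_parabola:
  assumes "a < b"
  shows "path_image (parabola a b) = {z. a \<le> Re z \<and> Re z \<le> b \<and> Im z = (Re z - a) * (b - Re z)}"
proof (intro set_eqI iffI)
  fix z assume "z \<in> path_image (parabola a b)"
  then obtain t where t: "0 \<le> t" "t \<le> 1" "z = parabola a b t"
    unfolding path_image_def by auto
  have "t * (b - a) \<le> 1 * (b - a)"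
    using t assms by (intro mult_right_mono) auto
  moreover have "0 \<le> t * (b - a)"
    using t assms by simp
  ultimately show "z \<in> {z. a \<le> Re z \<and> Re z \<le> b \<and> Im z = (Re z - a) * (b - Re z)}"
    by (auto simp: t(3) parabola_def power2_eq_square algebra_simps)
next
  fix z assume z: "z \<in> {z. a \<le> Re z \<and> Re z \<le> b \<and> Im z = (Re z - a) * (b - Re z)}"
  define t where "t = (Re z - a) / (b - a)"
  have t: "t * (b - a) = Re z - a"
    using assms by (simp add: t_def)
  have "t * (1 - t) * (b - a)\<^sup>2 = (t * (b - a)) * ((b - a) - t * (b - a))"
    by (simp add: power2_eq_square algebra_simps)
  then have "z = parabola a b t"
    using z t by (simp add: complex_eq_iff parabola_def)
  moreover have "t \<in> {0..1}"
    using z assms by (simp add: t_def)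
  ultimately show "z \<in> path_image (parabola a b)"
    unfolding path_image_def by blast
qed

lemma parabolas_disjoint:
  assumes "z \<in> path_image (parabola a b)" "z \<in> path_image (parabola c d)" "a < b" "c < d"
    and "(a, b) \<noteq> (c, d)" "\<not> (a < c \<and> c < b \<and> b < d)" "\<not> (c < a \<and> a < d \<and> d < b)"
  shows "\<exists>x \<in> {a, b} \<inter> {c, d}. z = of_real x"
proof -
  have nested: "\<exists>x \<in> {a, b} \<inter> {c, d}. z = of_real x"
    if "a \<le> Re z" "Re z \<le> b" "Im z = (Re z - a) * (b - Re z)"
       "c \<le> Re z" "Re z \<le> d" "Im z = (Re z - c) * (d - Re z)"
       "a \<le> c" "d \<le> b" "(a, b) \<noteq> (c, d)" for a b c d
  proof -
    \<comment> \<open>\<open>A\<close> and \<open>B\<close> are the distances from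
      \<open>Re z\<close> to the ends of the inner interval, \<open>u\<close> and \<open>v\<close>
      the amounts by which the outer one is wider. Equal heights force a sum of nonnegative products
      to vanish.\<close>
    define A B u v where "A = Re z - c" "B = d - Re z" "u = c - a" "v = b - d"
    note defs = this
    have nonneg: "0 \<le> A" "0 \<le> B" "0 \<le> u" "0 \<le> v"
      using that by (auto simp: defs)
    have "(A + u) * (B + v) = A * B"
      using that(3,6) by (simp add: defs)
    then have "A * v + u * B + u * v = 0"
      by (simp add: algebra_simps)
    moreover have "0 \<le> A * v" "0 \<le> u * B" "0 \<le> u * v"
      using nonneg by auto
    ultimately have "A * v = 0" "u * B = 0" "u * v = 0"
      by linarith+
    moreover have "u \<noteq> 0 \<or> v \<noteq> 0"
      using that(9) by (auto simp: defs)
    ultimately have "u = 0 \<and> A = 0 \<or> v = 0 \<and> B = 0"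
      by auto
    then show ?thesis
      using that(6) by (auto simp: defs complex_eq_iff)
  qed
  have z: "a \<le> Re z" "Re z \<le> b" "Im z = (Re z - a) * (b - Re z)"
    "c \<le> Re z" "Re z \<le> d" "Im z = (Re z - c) * (d - Re z)"
    using assms(1-4) by (auto simp: path_image_parabola)
  consider "a \<le> c" "d \<le> b" | "c \<le> a" "b \<le> d" | "b \<le> c" | "d \<le> a"
    using assms(6,7) by linarith
  then show ?thesis
  proof cases
    case 1
    then show ?thesis using nested[OF z] assms(5) by blast
  next
    case 2
    then show ?thesis using nested[OF z(4-6,1-3)] assms(5) by blast
  next
    case 3
    then have "Re z = b" "b = c" using z by linarith+
    then show ?thesis using z(3) by (auto simp: complex_eq_iff)
  next
    case 4
    then have "Re z = a" "a = d" using z by linarith+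
    then show ?thesis using z(3) by (auto simp: complex_eq_iff)
  qed
qed

lemma path_image_apex_segment:
  "path_image (linepath (- \<i>) (of_real y)) = {Complex (t * y) (t - 1) | t. 0 \<le> t \<and> t \<le> 1}"
proof -
  have "(1 - t) *\<^sub>R (- \<i>) + t *\<^sub>R of_real y = Complex (t * y) (t - 1)" for t
    by (simp add: complex_eq_iff)
  then show ?thesis
    by (simp only: path_image_linepath closed_segment_def)
qed

text \<open>
  One-page book embedding: the vertices lie on the real line in preorder, forest edges are drawn
  in the upper half plane, and the apex \<open>0\<close> lies at \<open>- \<i>\<close> below the line.
\<close>

lemma planar_one_page:
  fixes G :: "nat pair_pre_digraph"
  assumes edges: "\<And>e. e \<in> undirected_edges G \<Longrightarrow>
      \<exists>x y. e = {x, y} \<and> x < y \<and> y \<in> pverts G \<and> x \<in> pverts G \<and> (x = 0 \<or> (x, y) \<in> E)"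
    and page: "\<And>x y x' y'. \<lbrakk>(x, y) \<in> E; (x', y') \<in> E\<rbrakk> \<Longrightarrow> \<not> (x < x' \<and> x' < y \<and> y < y')"
  shows "planar G"
proof -
  define p :: "nat \<Rightarrow> complex" where "p = (\<lambda>x. if x = 0 then - \<i> else of_nat x)"
  define \<gamma> :: "nat set \<Rightarrow> real \<Rightarrow> complex" where
    "\<gamma> = (\<lambda>e. if Min e = 0 then linepath (- \<i>) (of_real (Max e)) else parabola (Min e) (Max e))"
  have inj: "inj p"
    by (auto simp: inj_on_def p_def complex_eq_iff)
  have \<gamma>0: "\<gamma> {0, y} = linepath (- \<i>) (of_real (real y))" if "0 < y" for y
    using that by (simp add: \<gamma>_def)
  have \<gamma>_pos: "\<gamma> {x, y} = parabola x y" if "0 < x" "x < y" for x y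
    using that by (simp add: \<gamma>_def min_def max_def)
  have image0: "path_image (\<gamma> {0, y}) = {Complex (t * y) (t - 1) | t :: real. 0 \<le> t \<and> t \<le> 1}" if "0 < y" for y
    unfolding \<gamma>0[OF that] by (rule path_image_apex_segment)
  have image_pos: "path_image (\<gamma> {x, y}) =
      {z. x \<le> Re z \<and> Re z \<le> y \<and> Im z = (Re z - x) * (y - Re z)}" if "0 < x" "x < y" for x y
    unfolding \<gamma>_pos[OF that] using that by (intro path_image_parabola) simp
  have ends: "Path_Connected.arc (\<gamma> {x, y}) \<and>
      {pathstart (\<gamma> {x, y}), pathfinish (\<gamma> {x, y})} = p ` {x, y}" if "x < y" for x y
  proof (cases "x = 0")
    case True
    then show ?thesis
      using that by (auto simp: \<gamma>0 p_def complex_eq_iff intro!: arc_linepath)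
  next
    case False
    then show ?thesis
      using that by (auto simp: \<gamma>_pos p_def arc_parabola parabola_def pathstart_def pathfinish_def complex_eq_iff)
  qed
  have sub: "p ` {x, y} \<subseteq> path_image (\<gamma> {x, y})" if "x < y" for x y
    using ends[OF that] pathstart_in_path_image[of "\<gamma> {x, y}"] pathfinish_in_path_image[of "\<gamma> {x, y}"]
    by (metis empty_subsetI insert_subset)
  have vertex: "v \<in> {x, y}" if xy: "x < y" "p v \<in> path_image (\<gamma> {x, y})" for x y v
  proof (cases "x = 0")
    case True
    then obtain t :: real where "p v = Complex (t * y) (t - 1)"
      using xy by (auto simp: image0)
    then show ?thesis
      using True by (cases "v = 0") (auto simp: p_def complex_eq_iff)
  next
    case False
    then have im: "real x \<le> Re (p v)" "Im (p v) = (Re (p v) - x) * (y - Re (p v))"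
      using that by (auto simp: image_pos)
    then have "v > 0"
      using False by (cases "v = 0") (auto simp: p_def)
    then show ?thesis
      using im by (auto simp: p_def)
  qed
  have cross: "z \<in> p ` ({x, y} \<inter> {x', y'})"
    if xy: "x < y" "x' < y'" "x = 0 \<or> (x, y) \<in> E" "x' = 0 \<or> (x', y') \<in> E" "{x, y} \<noteq> {x', y'}"
      and z: "z \<in> path_image (\<gamma> {x, y})" "z \<in> path_image (\<gamma> {x', y'})" for x y x' y' z
  proof -
    have mixed: "z \<in> p ` ({0, y} \<inter> {x', y'})"
      if yz: "0 < y" "0 < x'" "x' < y'" "z \<in> path_image (\<gamma> {0, y})" "z \<in> path_image (\<gamma> {x', y'})"
      for y x' y'
    proof -
      obtain t :: real where t: "z = Complex (t * y) (t - 1)" "t \<le> 1"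
        using yz by (auto simp: image0)
      \<comment> \<open>The parabola stays on or above the real line and the segment on or below it,
        so a common point is the upper end of the segment.\<close>
      have "real x' \<le> Re z" "Re z \<le> y'" "Im z = (Re z - x') * (y' - Re z)"
        using that by (auto simp: image_pos)
      then have "0 \<le> Im z"
        by simp
      then have "t = 1"
        using t by simp
      then have "z = p y"
        using t(1) \<open>0 < y\<close> by (simp add: p_def complex_eq_iff)
      then show ?thesis
        using vertex[of x' y' y] that by auto
    qed
    consider "x = 0" "x' = 0" | "x = 0" "0 < x'" | "0 < x" "x' = 0" | "0 < x" "0 < x'"
      by auto
    then show ?thesis
    proof cases
      case 1
      \<comment> \<open>Equal heights give equal parameters on the two segments; as \<open>y\<close>
        and \<open>y'\<close> differ, the parameter is 0 and the point is the apex.\<close>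
      then obtain s t :: real where "z = Complex (s * y) (s - 1)" "z = Complex (t * y') (t - 1)"
        using xy z by (auto simp: image0)
      moreover have "y \<noteq> y'"
        using 1 that by auto
      ultimately have "z = p 0"
        by (auto simp: p_def complex_eq_iff)
      then show ?thesis using 1 by simp
    next
      case 2
      then show ?thesis using mixed[of y x' y'] that by simp
    next
      case 3
      then show ?thesis using mixed[of y' x y] that by (simp add: Int_commute)
    next
      case 4
      then have "(real x, real y) \<noteq> (real x', real y')" "(x, y) \<in> E" "(x', y') \<in> E"
        using that by auto
      then have "\<exists>a \<in> {real x, real y} \<inter> {real x', real y'}. z = of_real a"
        using parabolas_disjoint[of z "real x" "real y" "real x'" "real y'"] z that(1,2) 4
          page[of x y x' y'] page[of x' y' x y] by (simp add: \<gamma>_pos)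
      then show ?thesis
        using 4 that(1,2) by (auto simp: p_def)
    qed
  qed
  have "plane_drawing G p \<gamma>"
    unfolding plane_drawing_def
  proof (intro conjI ballI impI)
    show "inj_on p (pverts G)"
      using inj by (rule inj_on_subset) simp
  next
    fix e assume "e \<in> undirected_edges G"
    then obtain x y where e: "e = {x, y}" "x < y" "x \<in> pverts G" "y \<in> pverts G"
      using edges by blast
    show "Path_Connected.arc (\<gamma> e)" "{pathstart (\<gamma> e), pathfinish (\<gamma> e)} = p ` e"
      using ends e by auto
    show "path_image (\<gamma> e) \<inter> p ` pverts G = p ` e"
      using vertex[OF e(2)] sub[OF e(2)] e by auto
  next
    fix e f assume "e \<in> undirected_edges G" "f \<in> undirected_edges G" "e \<noteq> f"
    then obtain x y x' y' where ef: "e = {x, y}" "x < y" "x = 0 \<or> (x, y) \<in> E"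
      "f = {x', y'}" "x' < y'" "x' = 0 \<or> (x', y') \<in> E" "{x, y} \<noteq> {x', y'}"
      using edges by metis
    show "path_image (\<gamma> e) \<inter> path_image (\<gamma> f) = p ` (e \<inter> f)"
    proof
      show "path_image (\<gamma> e) \<inter> path_image (\<gamma> f) \<subseteq> p ` (e \<inter> f)"
        using cross[OF ef(2,5,3,6,7)] ef(1,4) by blast
      show "p ` (e \<inter> f) \<subseteq> path_image (\<gamma> e) \<inter> path_image (\<gamma> f)"
        using sub[OF ef(2)] sub[OF ef(5)] ef(1,4) by blast
    qed
  qed
  then show ?thesis
    unfolding planar_def by blast
qed


section \<open>Binomial forests with shortcuts\<close>

text \<open>
  Below an informed parent, \<open>cluster j\<close> can be informed in \<open>j\<close> rounds; it consists of \<open>block i\<close>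
  for \<open>i < j\<close>. The parent calls the vertex in the middle of \<open>block (Suc r)\<close>, the first root of
  \<open>chain_right r\<close>, which calls its left neighbour, the last root of \<open>chain_left r\<close>. From there the
  message runs along the roots of each chain. This is the calling pattern of a binomial tree, but
  all the roots of a block are adjacent to the parent, which is why the depth is only about \<open>j / 3\<close>.
\<close>

fun cluster block chain_left chain_right :: "nat \<Rightarrow> oforest" where
  "cluster 0 = Empty"
| "cluster (Suc j) = cluster j \<frown> block j"
| "block 0 = Plant Empty Empty"
| "block (Suc r) = chain_left r \<frown> chain_right r"
| "chain_left 0 = Plant Empty Empty"
| "chain_left (Suc r) = chain_left r \<frown> Plant (cluster r) Empty"
| "chain_right 0 = Plant Empty Empty"
| "chain_right (Suc r) = Plant (cluster r) (chain_right r)"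

text \<open>The count for \<open>cluster j\<close> is one short of a power of two because the
  missing vertex is the parent that informs it.\<close>

lemma nodes_cluster_block:
  "Suc (nodes (cluster j)) = 2 ^ j" "nodes (block j) = 2 ^ j"
  "nodes (chain_left j) = 2 ^ j" "nodes (chain_right j) = 2 ^ j"
  by (induction j and j and j and j rule: cluster_block_chain_left_chain_right.induct) auto

lemma depth_cluster_mono: "i \<le> j \<Longrightarrow> depth (cluster i) \<le> depth (cluster j)"
  by (induction j rule: dec_induct) auto

text \<open>The roots of a chain are siblings, so a longer chain is not deeper by itself; only the
  largest cluster below a root counts.\<close>

lemma depth_chain: "depth (chain_left (Suc r)) \<le> Suc (depth (cluster r))"
  "depth (chain_right (Suc r)) \<le> Suc (depth (cluster r))"
  by (induction r) (use depth_cluster_mono[OF le_SucI[OF order_refl]] in \<open>auto intro: le_trans\<close>)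

text \<open>The largest block of \<open>cluster (i + 3)\<close> is \<open>block (i + 2)\<close>. It
  consists of two chains of dimension \<open>i + 1\<close>, whose roots carry clusters of dimension
  at most \<open>i\<close>. The bound is \<open>j / 3\<close> rounded up.\<close>

lemma depth_cluster: "depth (cluster j) \<le> (j + 2) div 3"
proof (induction j rule: less_induct)
  case (less j)
  have step: "depth (cluster (Suc (Suc (Suc i)))) \<le> max (depth (cluster (Suc (Suc i)))) (Suc (depth (cluster i)))" for i
    using depth_chain[of i] by simp
  \<comment> \<open>The induction removes the first argument of \<open>max\<close>, which stands for
    the smaller blocks.\<close>
  have "depth (cluster (Suc (Suc (Suc i)))) \<le> Suc (depth (cluster i))" for i
  proof (induction i)
    case 0
    then show ?case by (simp add: numeral_eq_Suc)
  next
    case (Suc i)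
    then show ?case
      using step[of "Suc i"] depth_cluster_mono[of i "Suc i"] by simp
  qed
  note depth3 = this
  consider "j < 3" | i where "j = Suc (Suc (Suc i))"
    by (cases j; cases "j - 1"; cases "j - 2") auto
  then show ?case
  proof cases
    case 1
    then have "j = 0 \<or> j = Suc 0 \<or> j = Suc (Suc 0)" by linarith
    then show ?thesis by auto
  next
    case 2
    then show ?thesis using depth3[of i] less.IH[of i] by simp
  qed
qed

text \<open>
  \<open>bulk a m\<close> is a binomial forest in which \<open>2 ^ m\<close> nodes (the parent included) carry a \<open>cluster a\<close>.
  \<open>partial_cluster a N\<close> keeps the blocks of \<open>cluster a\<close> at the binary digits of \<open>N\<close>.
\<close>

fun bulk :: "nat \<Rightarrow> nat \<Rightarrow> oforest" where
  "bulk a 0 = cluster a"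
| "bulk a (Suc m) = bulk a m \<frown> Plant (bulk a m) Empty"

fun partial_cluster :: "nat \<Rightarrow> nat \<Rightarrow> oforest" where
  "partial_cluster 0 N = Empty"
| "partial_cluster (Suc a) N =
     (if 2 ^ a \<le> N then partial_cluster a (N - 2 ^ a) \<frown> block a else partial_cluster a N)"

lemma nodes_bulk: "Suc (nodes (bulk a m)) = 2 ^ (a + m)"
  by (induction m) (auto simp: nodes_cluster_block)

lemma nodes_partial_cluster: "N < 2 ^ a \<Longrightarrow> nodes (partial_cluster a N) = N"
  by (induction a arbitrary: N) (auto simp: nodes_cluster_block)

lemma depth_partial_cluster: "depth (partial_cluster a N) \<le> depth (cluster a)"
proof (induction a arbitrary: N)
  case (Suc a)
  show ?case
    using Suc[of N] Suc[of "N - 2 ^ a"] by (auto simp: max_def)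
qed simp

section \<open>Broadcasting in fan graphs\<close>

context
  fixes G :: "nat pair_pre_digraph"
  assumes sym: "sym (parcs G)"
begin

text \<open>The message climbs tree edges, one level per round. Of the set \<open>P\<close> of
  vertices passed, later steps only need that it stays within the tree and contains both
  ends.\<close>

lemma informs_ancestor:
  assumes "fan_edges p s f \<subseteq> parcs G" "p < s" "v \<in> {s..<s + nodes f}"
  shows "\<exists>P \<subseteq> insert p {s..<s + nodes f}. p \<in> P \<and> v \<in> P \<and> informs G (depth f) {v} P"
  using assms
proof (induction f arbitrary: p s)
  case (Plant f g)
  let ?q = "Suc (s + nodes f)"
  have edges: "(p, s) \<in> parcs G" "fan_edges s (Suc s) f \<subseteq> parcs G" "fan_edges p ?q g \<subseteq> parcs G"
    using Plant.prems(1) by auto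
  have up: "(s, p) \<in> parcs G"
    using edges(1) sym by (rule symD[rotated])
  consider "v = s" | "v \<in> {Suc s..<Suc s + nodes f}" | "v \<in> {?q..<?q + nodes g}"
    using Plant.prems(3) by fastforce
  then show ?case
  proof cases
    case 1
    have "informs G 1 {v} {p, v}"
      using broadcast_step_call[OF up, of "{v}"] 1 by (simp add: eq_OO)
    then have "informs G (depth (Plant f g)) {v} {p, v}"
      by (rule informs_le) simp
    then show ?thesis
      using 1 by (intro exI[of _ "{p, v}"]) auto
  next
    case 2
    then obtain P where P: "P \<subseteq> insert s {Suc s..<Suc s + nodes f}" "s \<in> P" "v \<in> P"
        "informs G (depth f) {v} P"
      using Plant.IH(1)[OF edges(2)] by blast
    then have "informs G (Suc (depth f)) {v} (insert p P)"
      using broadcast_step_call[OF up] by (blast intro: relpowp_Suc_I)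
    then have "informs G (depth (Plant f g)) {v} (insert p P)"
      by (rule informs_le) simp
    moreover have "insert p P \<subseteq> insert p {s..<s + nodes (Plant f g)}"
      using P(1) by fastforce
    ultimately show ?thesis
      using P(3) by blast
  next
    case 3
    then obtain P where P: "P \<subseteq> insert p {?q..<?q + nodes g}" "p \<in> P" "v \<in> P"
        "informs G (depth g) {v} P"
      using Plant.IH(2)[OF edges(3)] Plant.prems(2) by fastforce
    have "informs G (depth (Plant f g)) {v} P"
      using P(4) by (rule informs_le) simp
    moreover have "P \<subseteq> insert p {s..<s + nodes (Plant f g)}"
      using P(1) by fastforce
    ultimately show ?thesis
      using P(2,3) by blast
  qed
qed simp

text \<open>Climb to \<open>p\<close>, then run the scheme of \<open>p\<close>; vertices informed
  during the climb do no harm by \<open>informs_from_superset\<close>.\<close>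

lemma informs_tree:
  assumes "fan_edges p s f \<subseteq> parcs G" "p < s" "v \<in> insert p {s..<s + nodes f}"
    and "informs G a {p} (insert p {s..<s + nodes f})" "depth f \<le> d"
  shows "informs G (d + a) {v} (insert p {s..<s + nodes f})"
proof -
  obtain P where P: "P \<subseteq> insert p {s..<s + nodes f}" "p \<in> P" "informs G (depth f) {v} P"
    using assms(3) informs_ancestor[OF assms(1,2), of v] informs_refl[of "depth f" G "{p}"] by blast
  have "informs G a P (insert p {s..<s + nodes f})"
    using assms(4) P(1,2) by (auto intro: informs_from_superset)
  with P(3) have "informs G (depth f + a) {v} (insert p {s..<s + nodes f})"
    by (rule informs_trans)
  then show ?thesis
    by (rule informs_le) (use assms(5) in simp)
qed

text \<open>The caller \<open>x\<close> need not be the parent \<open>p\<close>: the apex plays this role as well.\<close>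

lemma informs_append_interval:
  assumes "informs G j {x} (insert x {s..<t})" "informs G j {c} {t..<u}"
    and "(x, c) \<in> parcs G" "x < s" "s \<le> t" "t \<le> u"
  shows "informs G (Suc j) {x} (insert x {s..<u})"
proof -
  have "informs G (Suc j) {x} (insert x {s..<t} \<union> {t..<u})"
    using assms by (intro informs_call[of j G x _ c]) auto
  moreover have "insert x {s..<t} \<union> {t..<u} = insert x {s..<u}"
    using assms(4-6) by auto
  ultimately show ?thesis by simp
qed

section \<open>Schemes for clusters and blocks\<close>

lemma chain_nonempty [simp]: "chain_left r \<noteq> Empty" "chain_right r \<noteq> Empty"
  by (cases r; simp)+

definition block_entry :: "nat \<Rightarrow> nat \<Rightarrow> nat" where
  "block_entry s j = (case j of 0 \<Rightarrow> s | Suc r \<Rightarrow> s + 2 ^ r)"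

lemma first_root: "f \<noteq> Empty \<Longrightarrow> s \<in> roots s f"
  by (cases f) auto

lemma block_entry_root: "block_entry s j \<in> roots s (block j)"
  using first_root[OF chain_nonempty(2)]
  by (cases j) (auto simp: block_entry_def roots_append nodes_cluster_block)

text \<open>The last block is the largest, so its entry is called first. As the induction step for
  full and partial clusters alike, the lemma takes both induction hypotheses as premises about an
  arbitrary \<open>f\<close>.\<close>

lemma informs_append_block:
  assumes "fan_edges p s (f \<frown> block j) \<subseteq> parcs G"
    and "\<forall>y \<in> roots s (f \<frown> block j). (x, y) \<in> parcs G" "x < s"
    and "\<lbrakk>fan_edges p s f \<subseteq> parcs G; \<forall>y \<in> roots s f. (x, y) \<in> parcs G\<rbrakk>
      \<Longrightarrow> informs G j {x} (insert x {s..<s + nodes f})"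
    and "\<And>t. fan_edges p t (block j) \<subseteq> parcs G
      \<Longrightarrow> informs G j {block_entry t j} {t..<t + nodes (block j)}"
  shows "informs G (Suc j) {x} (insert x {s..<s + nodes (f \<frown> block j)})"
proof (rule informs_append_interval[where t = "s + nodes f" and c = "block_entry (s + nodes f) j"])
  show "informs G j {x} (insert x {s..<s + nodes f})"
    using assms(1,2,4) by (simp add: fan_edges_append roots_append)
  show "informs G j {block_entry (s + nodes f) j} {s + nodes f..<s + nodes (f \<frown> block j)}"
    using assms(1) assms(5)[of "s + nodes f"] by (simp add: fan_edges_append add.assoc)
  show "(x, block_entry (s + nodes f) j) \<in> parcs G"
    using assms(2) block_entry_root by (simp add: roots_append)
qed (use assms(3) in auto)

text \<open>Each chain is informed from the end at which it meets the other chain of its block. Only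
  clusters need a caller \<open>x\<close> apart from \<open>p\<close>: within blocks and chains,
  calls start at their own vertices.\<close>

lemma informs_cluster_block:
  "\<And>x p s. \<lbrakk>fan_edges p s (cluster j) \<subseteq> parcs G; \<forall>y \<in> roots s (cluster j). (x, y) \<in> parcs G; x < s\<rbrakk>
     \<Longrightarrow> informs G j {x} (insert x {s..<s + nodes (cluster j)})"
  "\<And>p s. fan_edges p s (block j) \<subseteq> parcs G
     \<Longrightarrow> informs G j {block_entry s j} {s..<s + nodes (block j)}"
  "\<And>p s. fan_edges p s (chain_left j) \<subseteq> parcs G
     \<Longrightarrow> informs G j {last_root s (chain_left j)} {s..<s + nodes (chain_left j)}"
  "\<And>p s. fan_edges p s (chain_right j) \<subseteq> parcs G
     \<Longrightarrow> informs G j {s} {s..<s + nodes (chain_right j)}"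
proof (induction j and j and j and j rule: cluster_block_chain_left_chain_right.induct)
  case (2 j)
  show ?case
    using 2 by (simp only: cluster.simps) (rule informs_append_block)
next
  case (4 r)
  let ?t = "s + nodes (chain_left r)"
  have edges: "fan_edges p s (chain_left r) \<subseteq> parcs G" "fan_edges p ?t (chain_right r) \<subseteq> parcs G"
    "(last_root s (chain_left r), ?t) \<in> parcs G"
    using "4.prems" by (auto simp: fan_edges_append)
  \<comment> \<open>The entry of the block uses its first call to cross to the left chain, against
    the orientation of the sibling edge.\<close>
  have "informs G (Suc r) {?t} ({?t..<?t + nodes (chain_right r)} \<union> {s..<?t})"
    using "4.IH"(1)[OF edges(1)] "4.IH"(2)[OF edges(2)] symD[OF sym edges(3)]
    by (intro informs_call) auto
  moreover have "{?t..<?t + nodes (chain_right r)} \<union> {s..<?t} = {s..<s + nodes (block (Suc r))}"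
    by auto
  ultimately show ?case
    by (simp add: block_entry_def nodes_cluster_block)
next
  case (6 r)
  let ?t = "s + nodes (chain_left r)"
  have edges: "fan_edges p s (chain_left r) \<subseteq> parcs G" "fan_edges ?t (Suc ?t) (cluster r) \<subseteq> parcs G"
    "(last_root s (chain_left r), ?t) \<in> parcs G"
    using "6.prems" by (auto simp: fan_edges_append)
  \<comment> \<open>For the cluster below \<open>?t\<close>, caller and parent coincide.\<close>
  have "\<forall>y \<in> roots (Suc ?t) (cluster r). (?t, y) \<in> parcs G"
    using edges(2) fan_edges_roots by blast
  then have "informs G r {?t} (insert ?t {Suc ?t..<Suc ?t + nodes (cluster r)})"
    using "6.IH"(2)[OF edges(2)] by simp
  then have "informs G (Suc r) {?t} (insert ?t {Suc ?t..<Suc ?t + nodes (cluster r)} \<union> {s..<?t})"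
    using "6.IH"(1)[OF edges(1)] symD[OF sym edges(3)] by (intro informs_call) auto
  moreover have "insert ?t {Suc ?t..<Suc ?t + nodes (cluster r)} \<union> {s..<?t} = {s..<s + nodes (chain_left (Suc r))}"
    by auto
  ultimately show ?case
    by (simp add: last_root_append)
next
  case (8 r)
  let ?t = "Suc (s + nodes (cluster r))"
  have edges: "fan_edges s (Suc s) (cluster r) \<subseteq> parcs G" "fan_edges p ?t (chain_right r) \<subseteq> parcs G"
    "(s, ?t) \<in> parcs G"
    using "8.prems" by auto
  have "\<forall>y \<in> roots (Suc s) (cluster r). (s, y) \<in> parcs G"
    using edges(1) fan_edges_roots by blast
  then have "informs G r {s} (insert s {Suc s..<Suc s + nodes (cluster r)})"
    using "8.IH"(1)[OF edges(1)] by simp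
  then have "informs G (Suc r) {s} (insert s {Suc s..<Suc s + nodes (cluster r)} \<union> {?t..<?t + nodes (chain_right r)})"
    using "8.IH"(2)[OF edges(2)] edges(3) by (intro informs_call) auto
  moreover have "insert s {Suc s..<Suc s + nodes (cluster r)} \<union> {?t..<?t + nodes (chain_right r)} =
      {s..<s + nodes (chain_right (Suc r))}"
    by auto
  ultimately show ?case
    by simp
qed (auto simp: block_entry_def)

text \<open>A binary digit 0 of \<open>N\<close> turns the call to the corresponding block into an
  idle round.\<close>

lemma informs_partial_cluster:
  "\<lbrakk>fan_edges p s (partial_cluster a N) \<subseteq> parcs G; \<forall>y \<in> roots s (partial_cluster a N). (x, y) \<in> parcs G; x < s\<rbrakk>
     \<Longrightarrow> informs G a {x} (insert x {s..<s + nodes (partial_cluster a N)})"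
proof (induction a arbitrary: N)
  case (Suc a)
  show ?case
  proof (cases "2 ^ a \<le> N")
    case True
    then have eq: "partial_cluster (Suc a) N = partial_cluster a (N - 2 ^ a) \<frown> block a"
      by simp
    show ?thesis
      unfolding eq
    proof (rule informs_append_block)
      show "fan_edges p s (partial_cluster a (N - 2 ^ a) \<frown> block a) \<subseteq> parcs G"
        "\<forall>y \<in> roots s (partial_cluster a (N - 2 ^ a) \<frown> block a). (x, y) \<in> parcs G" "x < s"
        using Suc.prems unfolding eq by blast+
    qed (use Suc.IH Suc.prems(3) informs_cluster_block(2) in blast)+
  next
    case False
    then have eq: "partial_cluster (Suc a) N = partial_cluster a N"
      by simp
    have "informs G a {x} (insert x {s..<s + nodes (partial_cluster a N)})"
      using Suc.prems unfolding eq by (rule Suc.IH)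
    then show ?thesis
      unfolding eq by (rule informs_le) simp
  qed
qed simp

section \<open>Schemes for the bulk, with and without one cluster\<close>

lemma informs_bulk:
  "\<lbrakk>fan_edges p s (bulk a m) \<subseteq> parcs G; \<forall>y \<in> roots s (bulk a m). (x, y) \<in> parcs G; x < s\<rbrakk>
     \<Longrightarrow> informs G (a + m) {x} (insert x {s..<s + nodes (bulk a m)})"
proof (induction m arbitrary: x p s)
  case 0
  then show ?case using informs_cluster_block(1) by simp
next
  case (Suc m)
  let ?t = "s + nodes (bulk a m)"
  have edges: "fan_edges p s (bulk a m) \<subseteq> parcs G" "fan_edges ?t (Suc ?t) (bulk a m) \<subseteq> parcs G"
    and roots: "\<forall>y \<in> roots s (bulk a m). (x, y) \<in> parcs G" "(x, ?t) \<in> parcs G"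
    using Suc.prems by (auto simp: fan_edges_append roots_append)
  have "\<forall>y \<in> roots (Suc ?t) (bulk a m). (?t, y) \<in> parcs G"
    using edges(2) fan_edges_roots by blast
  then have "informs G (a + m) {?t} (insert ?t {Suc ?t..<Suc ?t + nodes (bulk a m)})"
    using Suc.IH[OF edges(2)] by simp
  moreover have "insert ?t {Suc ?t..<Suc ?t + nodes (bulk a m)} = {?t..<s + nodes (bulk a (Suc m))}"
    by auto
  ultimately have "informs G (a + m) {?t} {?t..<s + nodes (bulk a (Suc m))}"
    by simp
  then have "informs G (Suc (a + m)) {x} (insert x {s..<s + nodes (bulk a (Suc m))})"
    using Suc.IH[OF edges(1) roots(1) Suc.prems(3)] roots(2) Suc.prems(3)
    by (intro informs_append_interval[where t = ?t]) auto
  then show ?case by simp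
qed

text \<open>
  The cluster \<open>K\<close> of the originator \<open>v\<close> is left to \<open>v\<close>. The remaining clusters cost the apex \<open>r\<close> one
  call per halving of the bulk, which leaves it \<open>a\<close> rounds for some other set \<open>S\<close>.
\<close>

lemma informs_bulk_except_cluster:
  assumes "fan_edges p s (bulk a m) \<subseteq> parcs G" "p < s"
    and "\<forall>y \<in> insert p {s..<s + nodes (bulk a m)}. (r, y) \<in> parcs G"
    and "v \<in> insert p {s..<s + nodes (bulk a m)}"
    and "informs G a {r} S" "S \<inter> insert p {s..<s + nodes (bulk a m)} = {}"
  shows "\<exists>K \<subseteq> insert p {s..<s + nodes (bulk a m)}. v \<in> K \<and>
    informs G (depth (cluster a) + a) {v} K \<and>
    informs G (a + m) {r} (S \<union> (insert p {s..<s + nodes (bulk a m)} - K))"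
  using assms
proof (induction m arbitrary: p s)
  case 0
  let ?V = "insert p {s..<s + nodes (cluster a)}"
  have edges: "fan_edges p s (cluster a) \<subseteq> parcs G"
    using 0 by simp
  \<comment> \<open>With a single cluster left, \<open>K\<close> is all of it: \<open>r\<close>
    makes no call here and keeps its \<open>a\<close> rounds for \<open>S\<close>.\<close>
  have "informs G a {p} ?V"
    using edges fan_edges_roots 0 by (intro informs_cluster_block(1)[OF edges]) blast+
  then have "informs G (depth (cluster a) + a) {v} ?V"
    using 0 by (intro informs_tree[OF edges]) simp_all
  then show ?case
    using 0 by (intro exI[of _ ?V]) simp
next
  case (Suc m)
  let ?t = "s + nodes (bulk a m)"
  let ?V = "insert p {s..<s + nodes (bulk a m)}"
  let ?W = "insert ?t {Suc ?t..<Suc ?t + nodes (bulk a m)}"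
  have edges: "fan_edges p s (bulk a m) \<subseteq> parcs G" "fan_edges ?t (Suc ?t) (bulk a m) \<subseteq> parcs G"
    using Suc.prems(1) by (auto simp: fan_edges_append)
  have split: "insert p {s..<s + nodes (bulk a (Suc m))} = ?V \<union> ?W"
    by auto
  have disjoint: "?V \<inter> ?W = {}"
    using Suc.prems(2) by auto
  have apex: "\<forall>y \<in> ?V. (r, y) \<in> parcs G" "\<forall>y \<in> ?W. (r, y) \<in> parcs G"
    and S: "S \<inter> ?V = {}" "S \<inter> ?W = {}"
    using Suc.prems(3,6) unfolding split by blast+
  have V: "informs G (a + m) {p} ?V"
    using edges(1) fan_edges_roots Suc.prems(2) by (intro informs_bulk[OF edges(1)]) blast+
  have W: "informs G (a + m) {?t} ?W"
    using edges(2) fan_edges_roots by (intro informs_bulk[OF edges(2)]) (blast, simp)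
  have "v \<in> ?V \<or> v \<in> ?W"
    using Suc.prems(4) unfolding split by blast
  then show ?case
  proof
    assume "v \<in> ?V"
    then obtain K where K: "K \<subseteq> ?V" "v \<in> K" "informs G (depth (cluster a) + a) {v} K"
        "informs G (a + m) {r} (S \<union> (?V - K))"
      using Suc.IH[OF edges(1) Suc.prems(2) apex(1) _ Suc.prems(5) S(1)] by blast
    \<comment> \<open>One call from \<open>r\<close> to the root \<open>?t\<close> hands over the
      half without \<open>v\<close>; the induction hypothesis covers the half with
      \<open>v\<close>.\<close>
    have "informs G (Suc (a + m)) {r} (S \<union> (?V - K) \<union> ?W)"
      using K(4) W by (rule informs_call) (use S(2) disjoint apex(2) in blast)+
    moreover have "S \<union> (?V - K) \<union> ?W = S \<union> (?V \<union> ?W - K)"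
      using K(1) disjoint by blast
    ultimately show ?thesis
      unfolding split using K(1-3) by (intro exI[of _ K]) auto
  next
    assume "v \<in> ?W"
    then obtain K where K: "K \<subseteq> ?W" "v \<in> K" "informs G (depth (cluster a) + a) {v} K"
        "informs G (a + m) {r} (S \<union> (?W - K))"
      using Suc.IH[OF edges(2) lessI apex(2) _ Suc.prems(5) S(2)] by blast
    have "informs G (Suc (a + m)) {r} (S \<union> (?W - K) \<union> ?V)"
      using K(4) V by (rule informs_call) (use S(1) disjoint apex(1) in blast)+
    moreover have "S \<union> (?W - K) \<union> ?V = S \<union> (?V \<union> ?W - K)"
      using K(1) disjoint by blast
    ultimately show ?thesis
      unfolding split using K(1-3) by (intro exI[of _ K]) auto
  qed
qed

end

section \<open>The broadcast graphs\<close>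

text \<open>Vertex 0 is the apex and vertex 1 the common parent of all roots, so the preorder
  numbering of the forest starts at 2.\<close>

definition apex_fan_graph :: "oforest \<Rightarrow> nat pair_pre_digraph" where
  "apex_fan_graph f = \<lparr>pverts = {..<nodes f + 2},
     parcs = (let E = {0} \<times> {1..<nodes f + 2} \<union> fan_edges 1 2 f in E \<union> E\<inverse>)\<rparr>"

lemma parcs_apex_fan_graph:
  "parcs (apex_fan_graph f) = {0} \<times> {1..<nodes f + 2} \<union> fan_edges 1 2 f \<union>
     ({0} \<times> {1..<nodes f + 2} \<union> fan_edges 1 2 f)\<inverse>"
  by (simp add: apex_fan_graph_def Let_def)

lemma pverts_apex_fan_graph [simp]: "pverts (apex_fan_graph f) = {..<nodes f + 2}"
  by (simp add: apex_fan_graph_def)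

lemma sym_apex_fan_graph: "sym (parcs (apex_fan_graph f))"
  unfolding parcs_apex_fan_graph by (rule sym_Un_converse)

lemma apex_fan_graph_bounds:
  "(x, y) \<in> {0} \<times> {1..<nodes f + 2} \<union> fan_edges 1 2 f \<Longrightarrow> x < y \<and> y < nodes f + 2"
  using fan_edges_bounds[of x y 1 2 f] by auto

lemma pair_graph_apex_fan_graph: "pair_graph (apex_fan_graph f)"
proof
  have bounds: "x \<noteq> y \<and> x < nodes f + 2 \<and> y < nodes f + 2" if "(x, y) \<in> parcs (apex_fan_graph f)" for x y
    using that apex_fan_graph_bounds[of x y f] apex_fan_graph_bounds[of y x f]
    unfolding parcs_apex_fan_graph by auto
  show "fst e \<in> pverts (apex_fan_graph f)" "snd e \<in> pverts (apex_fan_graph f)" "fst e \<noteq> snd e"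
    if "e \<in> parcs (apex_fan_graph f)" for e
    using bounds[of "fst e" "snd e"] that by auto
  have "parcs (apex_fan_graph f) \<subseteq> {..<nodes f + 2} \<times> {..<nodes f + 2}"
    using bounds by auto
  then show "finite (parcs (apex_fan_graph f))"
    by (rule finite_subset) simp
  show "symmetric (with_proj (apex_fan_graph f))"
    by (simp add: symmetric_def sym_apex_fan_graph)
qed simp

lemma connected_apex_fan_graph: "Digraph_Component.connected (with_proj (apex_fan_graph f))"
proof -
  let ?G = "apex_fan_graph f"
  interpret pair_graph ?G
    by (rule pair_graph_apex_fan_graph)
  have "u \<rightarrow>\<^sup>*\<^bsub>with_proj ?G\<^esub> v" if "u \<in> pverts ?G" "v \<in> pverts ?G" for u v
  proof -
    have "u \<rightarrow>\<^sup>*\<^bsub>with_proj ?G\<^esub> 0"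
    proof (cases "u = 0")
      case False
      then have "(u, 0) \<in> parcs ?G"
        using that by (auto simp: parcs_apex_fan_graph)
      then show ?thesis by auto
    qed auto
    moreover have "0 \<rightarrow>\<^sup>*\<^bsub>with_proj ?G\<^esub> v"
    proof (cases "v = 0")
      case False
      then have "(0, v) \<in> parcs ?G"
        using that by (auto simp: parcs_apex_fan_graph)
      then show ?thesis by auto
    qed auto
    ultimately show ?thesis by (rule reachable_trans)
  qed
  then have "strongly_connected (with_proj ?G)"
    by (intro strongly_connectedI) auto
  then show ?thesis
    using reachable_mk_symmetricI
    by (auto simp: connected_def strongly_connected_def)
qed

lemma planar_apex_fan_graph: "planar (apex_fan_graph f)"
proof (rule planar_one_page)
  fix e assume "e \<in> undirected_edges (apex_fan_graph f)"
  then obtain u w where e: "e = {u, w}" "(u, w) \<in> parcs (apex_fan_graph f)"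
    unfolding undirected_edges_def by auto
  define E where "E = {0} \<times> {1..<nodes f + 2} \<union> fan_edges 1 2 f"
  have "(u, w) \<in> E \<or> (w, u) \<in> E"
    using e(2) unfolding parcs_apex_fan_graph E_def by blast
  then obtain x y where xy: "e = {x, y}" "(x, y) \<in> E"
    using e(1) insert_commute[of u w "{}"] by metis
  have "x < y \<and> y < nodes f + 2"
    using xy(2) apex_fan_graph_bounds unfolding E_def by blast
  moreover have "x = 0 \<or> (x, y) \<in> fan_edges 1 2 f"
    using xy(2) by (simp add: E_def) blast
  ultimately show "\<exists>x y. e = {x, y} \<and> x < y \<and> y \<in> pverts (apex_fan_graph f) \<and>
      x \<in> pverts (apex_fan_graph f) \<and> (x = 0 \<or> (x, y) \<in> fan_edges 1 2 f)"
    using xy(1) by (intro exI[of _ x] exI[of _ y]) simp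
next
  fix x y x' y' assume "(x, y) \<in> fan_edges 1 2 f" "(x', y') \<in> fan_edges 1 2 f"
  then show "\<not> (x < x' \<and> x' < y \<and> y < y')"
    by (rule fan_edges_noncrossing) simp
qed

text \<open>The first call always joins the apex to one other vertex, and both ends then have
  \<open>a + m\<close> rounds. The apex as originator keeps \<open>D\<close> and leaves the bulk to
  1. An originator in the bulk or at 1 keeps one cluster and leaves the rest, with \<open>D\<close>,
  to the apex. An originator in \<open>D\<close> sees to \<open>D\<close> by way of 1 and leaves the
  bulk to the apex.\<close>

lemma informs_apex_fan_graph:
  assumes "N < 2 ^ a" "depth (cluster a) \<le> m"
    and "f = partial_cluster a N \<frown> bulk a m" "v \<in> pverts (apex_fan_graph f)"
  shows "informs (apex_fan_graph f) (Suc (a + m)) {v} (pverts (apex_fan_graph f))"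
proof -
  let ?G = "apex_fan_graph f"
  note sym = sym_apex_fan_graph[of f]
  define D where "D = {2..<2 + nodes (partial_cluster a N)}"
  define t where "t = 2 + nodes (partial_cluster a N)"
  define B where "B = {t..<t + nodes (bulk a m)}"
  have verts: "pverts ?G = insert 0 (insert 1 (D \<union> B))"
    by (auto simp: D_def B_def t_def assms(3))
  have disjoint: "0 \<notin> D" "1 \<notin> D" "0 \<notin> B" "1 \<notin> B" "D \<inter> B = {}"
    by (auto simp: D_def B_def t_def)
  have edges: "fan_edges 1 2 (partial_cluster a N) \<subseteq> parcs ?G" "fan_edges 1 t (bulk a m) \<subseteq> parcs ?G"
    by (auto simp: parcs_apex_fan_graph assms(3) fan_edges_append t_def)
  have apex: "(0, y) \<in> parcs ?G" "(y, 0) \<in> parcs ?G" if "y \<in> insert 1 (D \<union> B)" for y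
    using that by (auto simp: parcs_apex_fan_graph D_def B_def t_def assms(3))
  have roots: "roots 2 (partial_cluster a N) \<subseteq> D" "roots t (bulk a m) \<subseteq> B"
    unfolding D_def B_def by (rule roots_bounds)+
  have apex_roots: "\<forall>y \<in> roots 2 (partial_cluster a N). (0, y) \<in> parcs ?G"
    "\<forall>y \<in> roots t (bulk a m). (0, y) \<in> parcs ?G"
    using roots apex(1) by blast+
  have parent_roots: "\<forall>y \<in> roots 2 (partial_cluster a N). (1, y) \<in> parcs ?G"
    "\<forall>y \<in> roots t (bulk a m). (1, y) \<in> parcs ?G"
    using edges fan_edges_roots by blast+
  have D0: "informs ?G a {0} (insert 0 D)" and D1: "informs ?G a {1} (insert 1 D)"
    unfolding D_def
    using informs_partial_cluster[OF sym edges(1) apex_roots(1)]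
      informs_partial_cluster[OF sym edges(1) parent_roots(1)] by simp_all
  have B0: "informs ?G (a + m) {0} (insert 0 B)" and B1: "informs ?G (a + m) {1} (insert 1 B)"
    unfolding B_def
    using informs_bulk[OF sym edges(2) apex_roots(2)]
      informs_bulk[OF sym edges(2) parent_roots(2)] by (simp_all add: t_def)
  consider "v = 0" | "v \<in> insert 1 B" | "v \<in> D"
    using assms(4) unfolding verts by blast
  then show ?thesis
  proof cases
    case 1
    have "informs ?G (Suc (a + m)) {0} (insert 0 D \<union> insert 1 B)"
      using informs_le[OF D0] B1 by (rule informs_call) (use disjoint apex in auto)
    moreover have "insert 0 D \<union> insert 1 B = pverts ?G"
      unfolding verts by blast
    ultimately show ?thesis using 1 by simp
  next
    case 2
    have "\<exists>K \<subseteq> insert 1 B. v \<in> K \<and> informs ?G (depth (cluster a) + a) {v} K \<and>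
        informs ?G (a + m) {0} (insert 0 D \<union> (insert 1 B - K))"
      unfolding B_def
    proof (rule informs_bulk_except_cluster[OF sym edges(2)])
      show "1 < t" by (simp add: t_def)
      show "\<forall>y \<in> insert 1 {t..<t + nodes (bulk a m)}. (0, y) \<in> parcs ?G"
        using apex(1) by (auto simp: B_def)
      show "v \<in> insert 1 {t..<t + nodes (bulk a m)}"
        using 2 by (simp add: B_def)
      show "insert 0 D \<inter> insert 1 {t..<t + nodes (bulk a m)} = {}"
        using disjoint by (auto simp: B_def)
    qed (rule D0)
    then obtain K where K: "K \<subseteq> insert 1 B" "v \<in> K" "informs ?G (depth (cluster a) + a) {v} K"
        "informs ?G (a + m) {0} (insert 0 D \<union> (insert 1 B - K))"
      by blast
    \<comment> \<open>Of these rounds, \<open>m\<close> suffice for the climb to the root of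
      \<open>K\<close> and \<open>a\<close> for broadcasting from there.\<close>
    have "informs ?G (a + m) {v} K"
      using K(3) by (rule informs_le) (use assms(2) in simp)
    then have "informs ?G (Suc (a + m)) {v} (K \<union> (insert 0 D \<union> (insert 1 B - K)))"
      using K(4) by (rule informs_call) (use K(1) 2 disjoint apex in auto)
    moreover have "K \<union> (insert 0 D \<union> (insert 1 B - K)) = pverts ?G"
      unfolding verts using K(1) by blast
    ultimately show ?thesis by simp
  next
    case 3
    have "informs ?G (m + a) {v} (insert 1 D)"
      unfolding D_def
      using 3 D1 depth_partial_cluster[of a N] assms(2)
      by (intro informs_tree[OF sym edges(1)]) (auto simp: D_def)
    then have "informs ?G (Suc (a + m)) {v} (insert 1 D \<union> insert 0 B)"
      unfolding add.commute[of m] using B0 by (rule informs_call) (use 3 disjoint apex in auto)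
    moreover have "insert 1 D \<union> insert 0 B = pverts ?G"
      unfolding verts by blast
    ultimately show ?thesis by simp
  qed
qed

theorem theorem7:
  fixes k n :: nat
  assumes "k \<ge> 1"
    and "2 ^ (k - 1) + 1 \<le> n"
    and "real n \<le> 2 ^ (k - 1) + 2 powi (\<lfloor>3 * real k / 4\<rfloor> - 1)"
  shows "\<exists>G :: nat pair_pre_digraph.
    broadcast_graph G \<and> planar G \<and> card (pverts G) = n \<and> broadcast_time G = k"
proof -
  have floor: "\<lfloor>3 * real k / 4\<rfloor> = int (3 * k div 4)"
    using floor_divide_of_nat_eq[of "3 * k" 4, where 'a = real] by simp
  \<comment> \<open>For \<open>k = 1\<close> the exponent is -1, so the range for \<open>n\<close>
    would run from 2 to 3/2.\<close>
  have "k \<noteq> 1"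
  proof
    assume "k = 1"
    then have "real n \<le> 1 + inverse 2" "2 \<le> n"
      using assms(2,3) floor by (auto simp: power_int_minus)
    then show False by simp
  qed
  with assms(1) have "2 \<le> k" by simp
  define a where "a = 3 * k div 4 - 1"
  define m where "m = k - 1 - a"
  have "1 \<le> 3 * k div 4"
    using \<open>2 \<le> k\<close> by simp
  then have exponent: "\<lfloor>3 * real k / 4\<rfloor> - 1 = int a"
    unfolding floor a_def by simp
  \<comment> \<open>The origin of 3/4: the climb of at most \<open>a / 3\<close> (rounded up) must
    fit into the \<open>m = k - 1 - a\<close> rounds left beside the \<open>a\<close> rounds of
    broadcasting.\<close>
  have k: "k = Suc (a + m)" and "(a + 2) div 3 \<le> m"
    using \<open>2 \<le> k\<close> unfolding a_def m_def by linarith+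
  then have m: "depth (cluster a) \<le> m"
    using depth_cluster le_trans by blast
  have "real n \<le> real (2 ^ (a + m) + 2 ^ a)"
    using assms(3) unfolding exponent by (simp add: k)
  then have n_le: "n \<le> 2 ^ (a + m) + 2 ^ a"
    by linarith
  have n_gt: "2 ^ (a + m) < n"
    using assms(2) k by simp
  \<comment> \<open>The bulk and vertex 1 account for \<open>2 ^ (a + m)\<close> vertices and the
    apex for one more; \<open>N\<close> counts the others. Counting the apex is what makes
    \<open>N < 2 ^ a\<close> strict at the largest \<open>n\<close>.\<close>
  define N where "N = n - 2 ^ (a + m) - 1"
  have N: "N < 2 ^ a"
    unfolding N_def using n_le n_gt by simp
  define f where "f = partial_cluster a N \<frown> bulk a m"
  have "nodes f + 2 = n"
    unfolding f_def using nodes_bulk[of a m] nodes_partial_cluster[OF N] n_gt by (simp add: N_def)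
  then have card: "card (pverts (apex_fan_graph f)) = n"
    by simp
  have time: "broadcast_time (apex_fan_graph f) = k"
    using informs_apex_fan_graph[OF N m f_def] n_gt card unfolding k
    by (intro broadcast_time_eqI) simp_all
  have "(2::nat) ^ a \<le> 2 ^ (a + m)"
    by simp
  with n_le have "n \<le> 2 ^ (a + m) + 2 ^ (a + m)"
    by linarith
  then have "n \<le> 2 ^ k"
    unfolding k by simp
  then have "\<lceil>log 2 (real n)\<rceil> = int k"
    using n_gt k ceiling_log_nat_eq_if[of 2 "a + m" n] by simp
  then have "broadcast_graph (apex_fan_graph f)"
    unfolding broadcast_graph_def card time
    using pair_graph_apex_fan_graph connected_apex_fan_graph by simp
  then show ?thesis
    using planar_apex_fan_graph card time by blast
qed

end
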